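(* Let $\mathcal{H}$ be a complex separable Hilbert space and let $T$ be an algebraic bounded linear operator on $\mathcal{H}$ whose monic minimal polynomial has degree $r\ge 2$ and real coefficients, written $$P(X)=X^r-a_{r-1}X^{r-1}-\cdots-a_1X-a_0,\qquad a_0,\dots,a_{r-1}\in\mathbb{R}.$$ Let $\lambda_1,\dots,\lambda_q\in\mathbb{C}$ be the distinct roots of $P$, with respective multiplicities $m_1,\dots,m_q$. Then, for every $n\ge r$, the powers of $T$ admit the following two representations. (Combinatorial representation) $$T^n=\sum_{s=0}^{r-1}\rho(n-s,r)\,W_s,\qquad W_s:=\sum_{j=s}^{r-1}a_j\,T^{s+r-1-j}\quad(s=0,\dots,r-1),$$ where $$\rho(m,r):=\sum_{\substack{\mathbf{k}\in\mathbb{Z}_+^r\\ \langle\mathbf{k},\mathbf{d}\rangle=m-r}}\binom{|\mathbf{k}|}{\mathbf{k}}\,a_0^{k_0}a_1^{k_1}\cdots a_{r-1}^{k_{r-1}},$$ with the conventions $\rho(r,r)=1$ and $\rho(m,r)=0$ for $m<r$. (Binet-type representation) $$T^n=\sum_{i=1}^{q}\sum_{j=0}^{m_i-1}C_{i,j}\,n^j\,\lambda_i^n,$$ where the bounded linear operators $C_{i,j}$ on $\mathcal{H}$ depend only on the initial terms $T^0,\dots,T^{r-1}$.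
   Context: A bounded operator $T$ on $\mathcal{H}$ is algebraic if $p(T)=0$ for some nonzero $p\in\mathbb{C}[X]$; its monic minimal polynomial is the monic polynomial of least degree annihilating $T$. $T^0$ is the identity operator. $\mathbb{Z}_+$ is the set of nonnegative integers. For $\mathbf{k}=(k_0,\dots,k_{r-1})\in\mathbb{Z}_+^r$: $|\mathbf{k}|=k_0+\cdots+k_{r-1}$; $\langle\mathbf{k},\mathbf{d}\rangle=k_0+2k_1+\cdots+rk_{r-1}$, where $\mathbf{d}=(1,2,\dots,r)$; and $\binom{|\mathbf{k}|}{\mathbf{k}}=\frac{|\mathbf{k}|!}{k_0!\cdots k_{r-1}!}$. Zeroth powers of scalars equal $1$.
   Formalization: The coefficients of P are renumbered: P(X)=X^r-a_0X^{r-1}-...-a_{r-2}X-a_{r-1}. With the printed numbering the combinatorial formula fails: for T=diag(1,-1), r=n=2, a_0=1, a_1=0, it gives T^2=T, but T^2=I. *)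

theory Defs
  imports "HOL-Analysis.Analysis" "HOL-Computational_Algebra.Polynomial"
begin

class scaleC =
  fixes scaleC :: "complex \<Rightarrow> 'a \<Rightarrow> 'a" (infixr \<open>*\<^sub>C\<close> 75)

(* The last axiom ties the complex structure to the real one; with r = 1 it
   also gives 1 *\<^sub>C x = x. *)
class complex_vector = real_vector + scaleC +
  assumes scaleC_add_right: "c *\<^sub>C (x + y) = c *\<^sub>C x + c *\<^sub>C y"
    and scaleC_add_left: "(c + d) *\<^sub>C x = c *\<^sub>C x + d *\<^sub>C x"
    and scaleC_scaleC: "c *\<^sub>C (d *\<^sub>C x) = (c * d) *\<^sub>C x"
    and scaleC_of_real: "complex_of_real r *\<^sub>C x = r *\<^sub>R x"

(* The inner product is linear in its first argument. *)
class complex_inner = complex_vector + real_normed_vector +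
  fixes cinner :: "'a \<Rightarrow> 'a \<Rightarrow> complex"
  assumes cinner_commute: "cinner x y = cnj (cinner y x)"
    and cinner_add_left: "cinner (x + y) z = cinner x z + cinner y z"
    and cinner_scaleC_left: "cinner (c *\<^sub>C x) y = c * cinner x y"
    and cinner_ge_zero: "0 \<le> Re (cinner x x)"
    and cinner_eq_zero_iff: "cinner x x = 0 \<longleftrightarrow> x = 0"
    and norm_eq_sqrt_cinner: "norm x = sqrt (Re (cinner x x))"

class complex_hilbert = complex_inner + complete_space

(* The library's bounded_linear is real-linear and bounded. *)
definition bounded_clinear :: "('a::complex_inner \<Rightarrow> 'a) \<Rightarrow> bool"
  where "bounded_clinear T \<longleftrightarrow> bounded_linear T \<and> (\<forall>c x. T (c *\<^sub>C x) = c *\<^sub>C T x)"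

definition poly_op :: "complex poly \<Rightarrow> ('a::complex_inner \<Rightarrow> 'a) \<Rightarrow> 'a \<Rightarrow> 'a"
  where "poly_op p T = (\<lambda>x. \<Sum>i\<le>degree p. coeff p i *\<^sub>C (T ^^ i) x)"

definition algebraic_op :: "('a::complex_inner \<Rightarrow> 'a) \<Rightarrow> bool"
  where "algebraic_op T \<longleftrightarrow> (\<exists>p. p \<noteq> 0 \<and> poly_op p T = (\<lambda>x. 0))"

definition is_monic_minimal_poly :: "('a::complex_inner \<Rightarrow> 'a) \<Rightarrow> complex poly \<Rightarrow> bool"
  where "is_monic_minimal_poly T p \<longleftrightarrow>
    lead_coeff p = 1 \<and> poly_op p T = (\<lambda>x. 0) \<and>
    (\<forall>q. lead_coeff q = 1 \<and> poly_op q T = (\<lambda>x. 0) \<longrightarrow> degree p \<le> degree q)"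

(* X^r - a 0 X^(r-1) - ... - a (r-2) X - a (r-1), the characteristic polynomial of
   V (n+1) = a 0 V n + a 1 V (n-1) + ... + a (r-1) V (n-r+1).
   The formulas for rho and W_op below need the coefficients to be numbered in this
   order. If a j were the coefficient of X^j instead, the operator T = diag(1, -1) on C^2
   has r = 2, a 0 = 1, a 1 = 0, and the representation of T^2 = I would give
   W_0 = a 0 T + a 1 I = T. *)
definition rec_poly :: "nat \<Rightarrow> (nat \<Rightarrow> real) \<Rightarrow> complex poly"
  where "rec_poly r a = monom 1 r - (\<Sum>j<r. monom (complex_of_real (a j)) (r - 1 - j))"

(* Extensional functions on {..<r} represent r-tuples of nonnegative integers.
   Writing <k,d> + r = m instead of <k,d> = m - r avoids truncated subtraction:
   the sum is empty for m < r, and rho a r r = 1 comes from k = 0. *)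
definition rho :: "(nat \<Rightarrow> real) \<Rightarrow> nat \<Rightarrow> nat \<Rightarrow> real"
  where "rho a m r =
    (\<Sum>k\<in>{k \<in> {..<r} \<rightarrow>\<^sub>E UNIV. (\<Sum>i<r. (i + 1) * k i) + r = m}.
      fact (\<Sum>i<r. k i) / (\<Prod>i<r. fact (k i)) * (\<Prod>i<r. a i ^ k i))"

definition W_op :: "(nat \<Rightarrow> real) \<Rightarrow> nat \<Rightarrow> ('a::complex_inner \<Rightarrow> 'a) \<Rightarrow> nat \<Rightarrow> 'a \<Rightarrow> 'a"
  where "W_op a r T s = (\<lambda>x. \<Sum>j=s..r-1. a j *\<^sub>R (T ^^ (s + r - 1 - j)) x)"

end

theory Submission
  imports
    Defs
    "HOL-Computational_Algebra.Polynomial_Factorial"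
    "HOL-Computational_Algebra.Field_as_Ring"
    "HOL-Computational_Algebra.Fundamental_Theorem_Algebra"
begin

text \<open>
  Everything is a statement about the powers of \<open>X\<close> modulo
  \<open>P = X ^ r - a 0 * X ^ (r - 1) - \<dots> - a (r - 1)\<close>, because \<open>p \<mapsto> p(T)\<close> is a ring
  homomorphism that kills the multiples of \<open>P\<close>. The operators \<open>C i j\<close> are polynomials in \<open>T\<close>,
  and boundedness is inherited from \<open>T\<close>.

  The combinatorial representation solves the recurrence
  \<open>v n = \<Sum>j<r. a j *\<^sub>R v (n - 1 - j)\<close>, which the orbit \<open>v n = (T ^^ n) x\<close> satisfies for
  \<open>n \<ge> r\<close>. The absorption identity for multinomial coefficients
  (\<open>multinomial_term_upd_Suc\<close>) shows that \<open>rho\<close> is the impulse response of that recurrence: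
  it is \<open>0\<close> before \<open>r\<close>, is \<open>1\<close> at \<open>r\<close> and obeys the recurrence afterwards
  (\<open>rho_recurrence\<close>). A solution that starts from initial values \<open>v 0, \<dots>, v (r - 1)\<close> is
  therefore the response to the inputs that these values feed into the recurrence at the times
  \<open>r, \<dots>, 2 r - 1\<close>, and the input at time \<open>r + s\<close> is \<open>W\<^sub>s\<close> (\<open>recurrence_solution_rho\<close>).

  For the Binet representation, write \<open>P\<close> as the product of the pairwise coprime blocks
  \<open>f\<^sub>z = (X - z)\<^sup>m\<close>, where \<open>z\<close> runs over the roots and \<open>m\<close> is the multiplicity of \<open>z\<close>.
  Bezout's identity for the cofactors \<open>g\<^sub>z = P / f\<^sub>z\<close> gives \<open>\<Sum>z. u\<^sub>z g\<^sub>z = 1\<close>. In the summand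
  \<open>u\<^sub>z g\<^sub>z X\<^sup>n\<close> one may replace \<open>X\<^sup>n\<close> by its Taylor expansion at \<open>z\<close>, truncated
  before the exponent \<open>m\<close>, without changing the class modulo \<open>P\<close>. The Taylor
  coefficients \<open>(n choose k) * z ^ (n - k)\<close> are \<open>z ^ n\<close> times a polynomial in \<open>n\<close> of degree
  \<open>k < m\<close> (for \<open>z = 0\<close> both vanish once \<open>n \<ge> r\<close>). Sorting by powers of \<open>n\<close>
  produces the exponential polynomials together with polynomial coefficients that depend on
  \<open>P\<close> alone (\<open>monom_binet_mod\<close>). Reducing these modulo \<open>P\<close> expresses \<open>C i j\<close> through the
  first \<open>r\<close> powers of \<open>T\<close>.
\<close>

section \<open>The weights of the multinomial sums\<close>

definition multinomial_term :: "(nat \<Rightarrow> real) \<Rightarrow> nat \<Rightarrow> (nat \<Rightarrow> nat) \<Rightarrow> real"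
  where "multinomial_term a r k =
    fact (\<Sum>i<r. k i) / (\<Prod>i<r. fact (k i)) * (\<Prod>i<r. a i ^ k i)"

definition weighted_tuples :: "nat \<Rightarrow> nat \<Rightarrow> (nat \<Rightarrow> nat) set"
  where "weighted_tuples r m = {k \<in> {..<r} \<rightarrow>\<^sub>E UNIV. (\<Sum>i<r. (i + 1) * k i) + r = m}"

lemma rho_eq_sum_multinomial_term:
  "rho a m r = (\<Sum>k\<in>weighted_tuples r m. multinomial_term a r k)"
  by (simp add: rho_def weighted_tuples_def multinomial_term_def)

lemma finite_weighted_tuples: "finite (weighted_tuples r m)"
proof (rule finite_subset)
  show "weighted_tuples r m \<subseteq> {..<r} \<rightarrow>\<^sub>E {..m}"
  proof
    fix k assume k: "k \<in> weighted_tuples r m"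
    have "k i \<le> m" if "i < r" for i
    proof -
      have "k i \<le> (i + 1) * k i" by simp
      also have "\<dots> \<le> (\<Sum>i<r. (i + 1) * k i)"
        using that by (intro member_le_sum) auto
      also have "\<dots> \<le> m" using k by (simp add: weighted_tuples_def)
      finally show ?thesis .
    qed
    then show "k \<in> {..<r} \<rightarrow>\<^sub>E {..m}"
      using k by (auto simp: weighted_tuples_def PiE_iff)
  qed
qed (auto intro: finite_PiE)

lemma sum_upd_Suc:
  fixes w :: "nat \<Rightarrow> nat"
  assumes "j < r"
  shows "(\<Sum>i<r. w i * (k(j := Suc (k j))) i) = (\<Sum>i<r. w i * k i) + w j"
proof -
  have "(\<Sum>i\<in>{..<r} - {j}. w i * (k(j := Suc (k j))) i) = (\<Sum>i\<in>{..<r} - {j}. w i * k i)"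
    by (intro sum.cong) auto
  then show ?thesis
    using assms by (simp add: sum.remove[of "{..<r}" j])
qed

text \<open>Raising one entry of the tuple multiplies the numerator of the multinomial coefficient
  by the new total, its denominator by the new entry, and the monomial by \<open>a j\<close>. Stated
  without divisions, this is the absorption identity for multinomial coefficients.\<close>

lemma multinomial_term_upd_Suc:
  assumes "j < r"
  shows "real (Suc (k j)) * multinomial_term a r (k(j := Suc (k j)))
       = real (Suc (\<Sum>i<r. k i)) * (a j * multinomial_term a r k)"
proof -
  let ?k = "k(j := Suc (k j))"
  have total: "(\<Sum>i<r. ?k i) = Suc (\<Sum>i<r. k i)"
    using sum_upd_Suc[OF assms, of "\<lambda>_. 1" k] by simp
  have "(\<Prod>i\<in>{..<r} - {j}. fact (?k i) :: real) = (\<Prod>i\<in>{..<r} - {j}. fact (k i))"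
    by (intro prod.cong) auto
  then have facts: "(\<Prod>i<r. fact (?k i) :: real) = real (Suc (k j)) * (\<Prod>i<r. fact (k i))"
    using assms by (simp add: prod.remove[of "{..<r}" j])
  have "(\<Prod>i\<in>{..<r} - {j}. a i ^ ?k i) = (\<Prod>i\<in>{..<r} - {j}. a i ^ k i)"
    by (intro prod.cong) auto
  then have powers: "(\<Prod>i<r. a i ^ ?k i) = a j * (\<Prod>i<r. a i ^ k i)"
    using assms by (simp add: prod.remove[of "{..<r}" j])
  show ?thesis
    unfolding multinomial_term_def total facts powers fact_Suc
    by (simp add: field_simps del: of_nat_Suc)
qed

lemma rho_eq_0: "m < r \<Longrightarrow> rho a m r = 0"
  by (simp add: rho_def)

lemma rho_self: "rho a r r = 1"
proof -
  have "weighted_tuples r r = {\<lambda>i\<in>{..<r}. 0}"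
    by (auto simp: weighted_tuples_def PiE_iff extensional_def)
  then show ?thesis
    by (simp add: rho_eq_sum_multinomial_term multinomial_term_def)
qed

text \<open>Tuples with \<open>k j = 0\<close> do not contribute, and lowering the \<open>j\<close>-th entry of the others by
  one is a bijection onto the tuples whose weight is smaller by \<open>j + 1\<close>.\<close>

lemma sum_weighted_tuples_shift:
  assumes j: "j < r" and m: "m > r"
  shows "(\<Sum>k\<in>weighted_tuples r m. real (k j) / real (\<Sum>i<r. k i) * multinomial_term a r k)
       = a j * rho a (m - 1 - j) r"
proof -
  let ?f = "\<lambda>k. real (k j) / real (\<Sum>i<r. k i) * multinomial_term a r k"
  have "(\<Sum>k\<in>weighted_tuples r m. ?f k) = (\<Sum>k\<in>{k \<in> weighted_tuples r m. k j > 0}. ?f k)"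
    by (intro sum.mono_neutral_right finite_weighted_tuples) auto
  also have "\<dots> = (\<Sum>k\<in>weighted_tuples r (m - 1 - j). a j * multinomial_term a r k)"
  proof (rule sum.reindex_bij_witness[where j = "\<lambda>k. k(j := k j - 1)"
        and i = "\<lambda>k. k(j := Suc (k j))"])
    fix k assume k: "k \<in> {k \<in> weighted_tuples r m. k j > 0}"
    let ?k = "k(j := k j - 1)"
    show k_eq: "?k(j := Suc (?k j)) = k"
      using k by auto
    have "(\<Sum>i<r. (i + 1) * k i) = (\<Sum>i<r. (i + 1) * ?k i) + (j + 1)"
      using sum_upd_Suc[OF j, of "\<lambda>i. i + 1" ?k] unfolding k_eq .
    then show "?k \<in> weighted_tuples r (m - 1 - j)"
      using k j by (auto simp: weighted_tuples_def PiE_iff extensional_def)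
    have total: "(\<Sum>i<r. k i) = Suc (\<Sum>i<r. ?k i)"
      using sum_upd_Suc[OF j, of "\<lambda>_. 1" ?k] unfolding k_eq by simp
    have "Suc (?k j) = k j"
      using k by simp
    then have "real (k j) * multinomial_term a r k
        = real (\<Sum>i<r. k i) * (a j * multinomial_term a r ?k)"
      using multinomial_term_upd_Suc[OF j, of ?k a] unfolding k_eq total by simp
    moreover have "real (\<Sum>i<r. k i) \<noteq> 0"
      unfolding of_nat_eq_0_iff total by simp
    ultimately show "a j * multinomial_term a r ?k = ?f k"
      by (simp add: nonzero_eq_divide_eq mult.commute del: of_nat_sum)
  next
    fix k assume k: "k \<in> weighted_tuples r (m - 1 - j)"
    show "(k(j := Suc (k j)))(j := (k(j := Suc (k j))) j - 1) = k"
      by auto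
    show "k(j := Suc (k j)) \<in> {k \<in> weighted_tuples r m. k j > 0}"
      using k j m sum_upd_Suc[OF j, of "\<lambda>i. i + 1" k]
      by (auto simp: weighted_tuples_def PiE_iff extensional_def)
  qed
  finally show ?thesis
    by (simp add: rho_eq_sum_multinomial_term sum_distrib_left)
qed

text \<open>The proportions \<open>k j / (\<Sum>i<r. k i)\<close> of a nonzero tuple add up to \<open>1\<close>. Splitting every
  multinomial term in these proportions turns \<open>rho\<close> into the sum of the shifted pieces above.
  The zero tuple, for which there are no proportions, occurs only at \<open>m = r\<close>.\<close>

lemma rho_recurrence:
  assumes m: "m > r"
  shows "rho a m r = (\<Sum>j<r. a j * rho a (m - 1 - j) r)"
proof -
  have split_one: "multinomial_term a r k
      = (\<Sum>j<r. real (k j) / real (\<Sum>i<r. k i) * multinomial_term a r k)"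
    if k: "k \<in> weighted_tuples r m" for k
  proof -
    have "real (\<Sum>i<r. k i) \<noteq> 0"
      unfolding of_nat_eq_0_iff using k m by (auto simp: weighted_tuples_def)
    then have "(\<Sum>j<r. real (k j) / real (\<Sum>i<r. k i)) = 1"
      unfolding sum_divide_distrib[symmetric] of_nat_sum[symmetric] by (rule divide_self)
    then show ?thesis
      unfolding sum_distrib_right[symmetric] by simp
  qed
  have "rho a m r = (\<Sum>k\<in>weighted_tuples r m. \<Sum>j<r.
      real (k j) / real (\<Sum>i<r. k i) * multinomial_term a r k)"
    unfolding rho_eq_sum_multinomial_term by (intro sum.cong refl split_one)
  also have "\<dots> = (\<Sum>j<r. a j * rho a (m - 1 - j) r)"
    by (subst sum.swap, intro sum.cong refl sum_weighted_tuples_shift m) simp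
  finally show ?thesis .
qed

section \<open>Solving the recurrence by multinomial weights\<close>

text \<open>The right-hand side \<open>U\<close> is a superposition of impulse responses. It satisfies the same
  recurrence with zero initial values, driven by the extra input \<open>W (n - r)\<close> at the times
  \<open>r \<le> n < 2 * r\<close>. That input consists of exactly those terms of the recurrence for \<open>v\<close> that refer
  to an initial value, so \<open>U\<close> and \<open>v\<close> agree from \<open>r\<close> on.\<close>

lemma recurrence_solution_rho:
  fixes v :: "nat \<Rightarrow> 'b::real_vector"
  assumes rec: "\<And>n. n \<ge> r \<Longrightarrow> v n = (\<Sum>j<r. a j *\<^sub>R v (n - 1 - j))"
    and n: "n \<ge> r"
  shows "v n = (\<Sum>s<r. rho a (n - s) r *\<^sub>R (\<Sum>j=s..r - 1. a j *\<^sub>R v (s + r - 1 - j)))"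
proof -
  define W where "W s = (\<Sum>j=s..r - 1. a j *\<^sub>R v (s + r - 1 - j))" for s
  define U where "U n = (\<Sum>s<r. rho a (n - s) r *\<^sub>R W s)" for n
  have U_0: "U n = 0" if "n < r" for n
    unfolding U_def using that by (intro sum.neutral) (auto simp: rho_eq_0)
  (* This also holds at and before the impulse: there the truncated index n - 1 - j - s is below
     r, where rho vanishes. *)
  have rho_step: "rho a (n - s) r
      = (\<Sum>j<r. a j * rho a (n - 1 - j - s) r) + (if s = n - r then 1 else 0)"
    if n: "n \<ge> r" and s: "s < r" for n s
  proof -
    consider "n - s > r" | "n - s = r" | "n - s < r" by linarith
    then show ?thesis
    proof cases
      case 1
      then have "s \<noteq> n - r" by linarith
      with rho_recurrence[OF 1, of a] show ?thesis
        by (simp add: add.commute)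
    next
      case 2
      then have "n - 1 - j - s < r" for j using s by linarith
      moreover have "s = n - r" using 2 s by linarith
      ultimately show ?thesis
        using 2 by (simp add: rho_eq_0 rho_self)
    next
      case 3
      then have "n - 1 - j - s < r" for j by linarith
      moreover have "s \<noteq> n - r" using 3 n by linarith
      ultimately show ?thesis
        using 3 by (simp add: rho_eq_0)
    qed
  qed
  have U_rec: "U n = (\<Sum>j<r. a j *\<^sub>R U (n - 1 - j)) + (if n - r < r then W (n - r) else 0)"
    if n: "n \<ge> r" for n
  proof -
    have "U n = (\<Sum>s<r. (\<Sum>j<r. a j * rho a (n - 1 - j - s) r) *\<^sub>R W s)
        + (\<Sum>s<r. (if s = n - r then 1 else 0) *\<^sub>R W s)"
      unfolding U_def sum.distrib[symmetric]
      by (intro sum.cong refl) (simp add: rho_step[OF n] scaleR_left_distrib)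
    also have "(\<Sum>s<r. (\<Sum>j<r. a j * rho a (n - 1 - j - s) r) *\<^sub>R W s)
        = (\<Sum>j<r. a j *\<^sub>R U (n - 1 - j))"
      unfolding U_def scaleR_sum_left scaleR_sum_right
      by (subst sum.swap) simp
    also have "(\<Sum>s<r. (if s = n - r then 1 else 0) *\<^sub>R W s)
        = (\<Sum>s<r. if s = n - r then W s else 0)"
      by (intro sum.cong) auto
    also have "\<dots> = (if n - r < r then W (n - r) else 0)"
      by (simp add: sum.delta')
    finally show ?thesis .
  qed
  have W_eq: "(if n - r < r then W (n - r) else 0)
      = (\<Sum>j | j < r \<and> n - 1 - j < r. a j *\<^sub>R v (n - 1 - j))" if n: "n \<ge> r" for n
  proof (cases "n - r < r")
    case True
    have "{n - r..r - 1} = {j. j < r \<and> n - 1 - j < r}"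
      using n True by auto
    moreover have "n - r + r - 1 - j = n - 1 - j" for j
      using n by simp
    ultimately show ?thesis
      using True by (simp add: W_def)
  next
    case False
    then have "{j. j < r \<and> n - 1 - j < r} = {}" by auto
    then show ?thesis using False by (simp only: sum.empty if_False)
  qed
  have "U n = v n" if "n \<ge> r" for n
    using that
  proof (induction n rule: less_induct)
    case (less n)
    have U_prev: "U (n - 1 - j) = (if n - 1 - j < r then 0 else v (n - 1 - j))"
      if "j < r" for j
      using that less.prems less.IH[of "n - 1 - j"] by (auto simp: U_0)
    have "U n = (\<Sum>j<r. a j *\<^sub>R (if n - 1 - j < r then 0 else v (n - 1 - j)))
        + (\<Sum>j | j < r \<and> n - 1 - j < r. a j *\<^sub>R v (n - 1 - j))"
      unfolding U_rec[OF less.prems] W_eq[OF less.prems]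
      by (intro arg_cong2[where f = "(+)"] sum.cong refl) (simp_all only: U_prev lessThan_iff)
    also have "(\<Sum>j | j < r \<and> n - 1 - j < r. a j *\<^sub>R v (n - 1 - j))
        = (\<Sum>j<r. a j *\<^sub>R (if n - 1 - j < r then v (n - 1 - j) else 0))"
      by (intro sum.mono_neutral_cong_left) auto
    also have "(\<Sum>j<r. a j *\<^sub>R (if n - 1 - j < r then 0 else v (n - 1 - j))) + \<dots>
        = (\<Sum>j<r. a j *\<^sub>R v (n - 1 - j))"
      unfolding sum.distrib[symmetric] by (intro sum.cong) auto
    also have "\<dots> = v n"
      using rec[OF less.prems] by simp
    finally show ?case .
  qed
  with n show ?thesis by (simp add: U_def W_def)
qed

section \<open>Powers of the indeterminate modulo a polynomial\<close>

text \<open>By induction on the number of factors: a new factor \<open>f x\<close> is coprime to the product of the old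
  ones, so \<open>1 = v * f x + w * prod f F\<close>, and the old combination of cofactors, multiplied by
  \<open>f x\<close>, is a combination of new cofactors. The empty product has no cofactors, which is why
  \<open>I\<close> must be nonempty.\<close>

lemma bezout_cofactors:
  fixes f :: "'b \<Rightarrow> 'a::euclidean_ring_gcd"
  assumes "finite I" "I \<noteq> {}"
    and "\<And>i j. i \<in> I \<Longrightarrow> j \<in> I \<Longrightarrow> i \<noteq> j \<Longrightarrow> coprime (f i) (f j)"
  shows "\<exists>u. (\<Sum>i\<in>I. u i * (\<Prod>j\<in>I - {i}. f j)) = 1"
  using assms
proof (induction I rule: finite_ne_induct)
  case (singleton x)
  show ?case by (intro exI[of _ "\<lambda>_. 1"]) simp
next
  case (insert x F)
  then obtain u where u: "(\<Sum>i\<in>F. u i * (\<Prod>j\<in>F - {i}. f j)) = 1"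
    by blast
  have "coprime (f x) (\<Prod>j\<in>F. f j)"
    using insert by (intro prod_coprime_right) auto
  then obtain v w where vw: "v * f x + w * (\<Prod>j\<in>F. f j) = 1"
    using bezout_coefficients_fst_snd[of "f x" "\<Prod>j\<in>F. f j"]
    by (auto simp: coprime_iff_gcd_eq_1)
  let ?u = "\<lambda>i. if i = x then w else v * u i"
  have cofactor: "(\<Prod>j\<in>insert x F - {i}. f j) = f x * (\<Prod>j\<in>F - {i}. f j)" if "i \<in> F" for i
  proof -
    have "insert x F - {i} = insert x (F - {i})"
      using that insert.hyps by auto
    then show ?thesis
      using insert.hyps by simp
  qed
  have "(\<Sum>i\<in>insert x F. ?u i * (\<Prod>j\<in>insert x F - {i}. f j))
      = w * (\<Prod>j\<in>F. f j) + (\<Sum>i\<in>F. ?u i * (\<Prod>j\<in>insert x F - {i}. f j))"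
    using insert.hyps by simp
  also have "(\<Sum>i\<in>F. ?u i * (\<Prod>j\<in>insert x F - {i}. f j))
      = (\<Sum>i\<in>F. v * f x * (u i * (\<Prod>j\<in>F - {i}. f j)))"
    using insert.hyps by (intro sum.cong) (auto simp: cofactor mult_ac)
  also have "\<dots> = v * f x"
    unfolding sum_distrib_left[symmetric] u by simp
  finally show ?case
    using vw by (intro exI[of _ ?u]) (simp add: add.commute)
qed

lemma coprime_linear_powers:
  fixes z w :: "'a::field_gcd"
  assumes "z \<noteq> w"
  shows "coprime ([:-z, 1:] ^ m) ([:-w, 1:] ^ n)"
proof -
  have "coprime [:-z, 1:] [:-w, 1:]"
  proof (rule coprimeI)
    fix d assume d: "d dvd [:-z, 1:]" "d dvd [:-w, 1:]"
    then have "d dvd [:-w, 1:] - [:-z, 1:]"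
      by (rule dvd_diff[rotated])
    moreover have "is_unit ([:-w, 1:] - [:-z, 1:])"
      using assms by (simp add: is_unit_triv)
    ultimately show "is_unit d"
      by (rule dvd_trans)
  qed
  then show ?thesis by simp
qed

text \<open>The subtracted sum is the truncated Taylor expansion of \<open>X ^ n\<close> at \<open>z\<close>: expand
  \<open>((X - z) + z) ^ n\<close> by the binomial theorem.\<close>

lemma monom_taylor_dvd:
  fixes z :: "'a::comm_ring_1"
  shows "[:-z, 1:] ^ m dvd
    monom 1 n - (\<Sum>k<m. smult (of_nat (n choose k) * z ^ (n - k)) ([:-z, 1:] ^ k))"
proof -
  let ?Y = "[:-z, 1:]"
  let ?t = "\<lambda>k. smult (of_nat (n choose k) * z ^ (n - k)) (?Y ^ k)"
  have "monom 1 n = (?Y + [:z:]) ^ n"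
    by (simp add: monom_altdef)
  also have "\<dots> = (\<Sum>k\<le>n. of_nat (n choose k) * ?Y ^ k * [:z:] ^ (n - k))"
    by (rule binomial_ring)
  also have "\<dots> = (\<Sum>k\<le>n. ?t k)"
    by (intro sum.cong refl) (simp add: poly_const_pow of_nat_poly mult_ac)
  (* A summation range that can be cut at m whether or not m exceeds n. *)
  also have "\<dots> = (\<Sum>k<m + Suc n. ?t k)"
    by (intro sum.mono_neutral_left) (auto simp: binomial_eq_0)
  also have "\<dots> = (\<Sum>k<m. ?t k) + (\<Sum>k=m..<m + Suc n. ?t k)"
    unfolding lessThan_atLeast0 by (rule sum.atLeastLessThan_concat[symmetric]) simp_all
  finally have "monom 1 n - (\<Sum>k<m. ?t k) = (\<Sum>k=m..<m + Suc n. ?t k)"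
    by (simp add: algebra_simps)
  moreover have "?Y ^ m dvd \<dots>"
    by (intro dvd_sum dvd_smult le_imp_power_dvd) auto
  ultimately show ?thesis by metis
qed

lemma smult_sum_right: "smult c (\<Sum>i\<in>I. p i) = (\<Sum>i\<in>I. smult c (p i))"
  by (induction I rule: infinite_finite_induct) (simp_all add: smult_add_right)

lemma binomial_as_poly:
  "\<exists>p :: 'a::field_char_0 poly. degree p \<le> k \<and> (\<forall>n. poly p (of_nat n) = of_nat (n choose k))"
proof -
  let ?p = "smult (1 / fact k) (\<Prod>i<k. [:- of_nat i, 1:]) :: 'a poly"
  have "degree ?p \<le> k"
    using degree_prod_sum_le[of "{..<k}" "\<lambda>i. [:- of_nat i, 1:] :: 'a poly"] by simp
  moreover have "poly ?p (of_nat n) = of_nat (n choose k)" for n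
    by (simp add: poly_prod binomial_gbinomial gbinomial_prod_rev lessThan_atLeast0)
  ultimately show ?thesis by blast
qed

text \<open>The restriction \<open>n \<ge> degree P\<close> is there for the root \<open>0\<close>: its Taylor coefficients
  \<open>(n choose k) * 0 ^ (n - k)\<close> vanish only for \<open>n \<noteq> k\<close>, whereas the exponential polynomials
  belonging to \<open>0\<close> vanish for every \<open>n > 0\<close>.\<close>

lemma monom_binet_mod:
  fixes P :: "complex poly"
  assumes monic: "lead_coeff P = 1" and deg: "degree P > 0"
  shows "\<exists>Q :: complex \<Rightarrow> nat \<Rightarrow> complex poly. \<forall>n\<ge>degree P.
    P dvd monom 1 n
      - (\<Sum>z | poly P z = 0. \<Sum>j<order z P. smult (of_nat n ^ j * z ^ n) (Q z j))"
proof -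
  have [simp]: "P \<noteq> 0" using deg by auto
  define Z where "Z = {z. poly P z = 0}"
  define Y where "Y z = [:-z, 1:]" for z :: complex
  define f where "f z = Y z ^ order z P" for z
  define g where "g z = (\<Prod>w\<in>Z - {z}. f w)" for z
  have fin: "finite Z" unfolding Z_def by (simp add: poly_roots_finite)
  have P_prod: "P = (\<Prod>z\<in>Z. f z)"
    using complex_poly_decompose[of P] monic by (simp add: Z_def f_def Y_def)
  have "Z \<noteq> {}"
    using P_prod deg by auto
  moreover have "coprime (f z) (f w)" if "z \<noteq> w" for z w
    unfolding f_def Y_def using coprime_linear_powers[OF that] .
  ultimately obtain u where u: "(\<Sum>z\<in>Z. u z * g z) = 1"
    using bezout_cofactors[OF fin, of f] unfolding g_def by blast
  obtain b :: "nat \<Rightarrow> complex poly"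
    where b_deg: "\<And>k. degree (b k) \<le> k"
      and b: "\<And>k n. poly (b k) (of_nat n) = of_nat (n choose k)"
    using binomial_as_poly by metis
  (* For z = 0 the default inverse 0 = 0 makes these coefficients meaningless, but they are
     multiplied by 0 ^ n with n > 0. *)
  define Q where "Q z j = u z * g z *
    (\<Sum>k<order z P. smult (inverse z ^ k * coeff (b k) j) (Y z ^ k))" for z j
  have "P dvd monom 1 n - (\<Sum>z\<in>Z. \<Sum>j<order z P. smult (of_nat n ^ j * z ^ n) (Q z j))"
    if n: "n \<ge> degree P" for n
  proof -
    let ?t = "\<lambda>z. \<Sum>k<order z P. smult (of_nat (n choose k) * z ^ (n - k)) (Y z ^ k)"
    have block: "(\<Sum>j<order z P. smult (of_nat n ^ j * z ^ n) (Q z j)) = u z * g z * ?t z" for z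
    proof -
      have term_eq: "(\<Sum>j<order z P. of_nat n ^ j * z ^ n * (inverse z ^ k * coeff (b k) j))
          = of_nat (n choose k) * z ^ (n - k)" if k: "k < order z P" for k
      proof -
        have kn: "k < n" using k order_degree[of P z] n by simp
        have "of_nat (n choose k) = (\<Sum>j<order z P. coeff (b k) j * of_nat n ^ j)"
        proof -
          have "of_nat (n choose k) = (\<Sum>j\<le>degree (b k). coeff (b k) j * of_nat n ^ j)"
            unfolding b[symmetric] by (rule poly_altdef)
          also have "\<dots> = (\<Sum>j<order z P. coeff (b k) j * of_nat n ^ j)"
            using b_deg[of k] k by (intro sum.mono_neutral_left) (auto simp: coeff_eq_0)
          finally show ?thesis .
        qed
        moreover have "z ^ (n - k) = z ^ n * inverse z ^ k"
          using kn by (cases "z = 0") (auto simp: power_0_left power_diff field_simps)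
        ultimately show ?thesis
          by (simp add: sum_distrib_left sum_distrib_right mult_ac)
      qed
      have "(\<Sum>j<order z P. smult (of_nat n ^ j * z ^ n) (Q z j))
          = u z * g z * (\<Sum>j<order z P. \<Sum>k<order z P.
              smult (of_nat n ^ j * z ^ n * (inverse z ^ k * coeff (b k) j)) (Y z ^ k))"
        by (simp add: Q_def smult_sum_right sum_distrib_left)
      also have "\<dots> = u z * g z * ?t z"
        by (subst sum.swap) (simp add: smult_sum[symmetric] term_eq)
      finally show ?thesis .
    qed
    have "monom 1 n - (\<Sum>z\<in>Z. \<Sum>j<order z P. smult (of_nat n ^ j * z ^ n) (Q z j))
        = (\<Sum>z\<in>Z. u z * g z) * monom 1 n - (\<Sum>z\<in>Z. u z * g z * ?t z)"
      unfolding u block by simp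
    also have "\<dots> = (\<Sum>z\<in>Z. u z * (g z * (monom 1 n - ?t z)))" (is "_ = ?R")
      by (simp add: sum_distrib_right sum_subtractf right_diff_distrib mult.assoc)
    finally have diff_eq: "monom 1 n
        - (\<Sum>z\<in>Z. \<Sum>j<order z P. smult (of_nat n ^ j * z ^ n) (Q z j)) = ?R" .
    show ?thesis
      unfolding diff_eq
    proof (rule dvd_sum, rule dvd_mult)
      fix z assume z: "z \<in> Z"
      have P_eq: "P = g z * f z"
        unfolding P_prod g_def using prod.remove[OF fin z, of f] by (simp add: mult.commute)
      have "g z * f z dvd g z * (monom 1 n - ?t z)"
        unfolding f_def Y_def by (intro mult_dvd_mono monom_taylor_dvd dvd_refl)
      then show "P dvd g z * (monom 1 n - ?t z)"
        unfolding P_eq[symmetric] .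
    qed
  qed
  then show ?thesis unfolding Z_def by blast
qed

section \<open>Polynomials in an operator\<close>

global_interpretation complex_module: module "scaleC :: complex \<Rightarrow> 'a \<Rightarrow> 'a::complex_vector"
  by unfold_locales (simp_all add: scaleC_add_right scaleC_add_left scaleC_scaleC
      scaleC_of_real[of 1, simplified])

lemma norm_scaleC: "norm (c *\<^sub>C x) = cmod c * norm (x :: 'a::complex_inner)"
proof -
  have "cinner (c *\<^sub>C x) (c *\<^sub>C x) = c * cnj (cinner (c *\<^sub>C x) x)"
    by (metis cinner_scaleC_left cinner_commute)
  also have "\<dots> = (c * cnj c) * cinner x x"
    by (metis cinner_scaleC_left cinner_commute complex_cnj_mult mult.assoc)
  also have "\<dots> = complex_of_real ((cmod c)\<^sup>2) * cinner x x"
    by (simp add: complex_norm_square[symmetric])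
  finally have "Re (cinner (c *\<^sub>C x) (c *\<^sub>C x)) = (cmod c)\<^sup>2 * Re (cinner x x)"
    by simp
  then show ?thesis
    by (simp add: norm_eq_sqrt_cinner real_sqrt_mult)
qed

lemma bounded_clinear_compose:
  "bounded_clinear S \<Longrightarrow> bounded_clinear T \<Longrightarrow> bounded_clinear (\<lambda>x. S (T x))"
  by (auto simp: bounded_clinear_def intro: bounded_linear_compose)

lemma bounded_clinear_scaleC: "bounded_clinear (\<lambda>x. c *\<^sub>C (x :: 'a::complex_inner))"
proof -
  have "bounded_linear (\<lambda>x. c *\<^sub>C (x :: 'a))"
  proof (rule bounded_linear_intro[where K = "cmod c"])
    show "c *\<^sub>C (t *\<^sub>R x) = t *\<^sub>R (c *\<^sub>C x)" for t and x :: 'a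
      by (simp add: scaleC_of_real[symmetric] mult.commute)
  qed (simp_all add: complex_module.scale_right_distrib norm_scaleC mult.commute)
  then show ?thesis
    by (simp add: bounded_clinear_def mult.commute)
qed

lemma bounded_clinear_funpow: "bounded_clinear T \<Longrightarrow> bounded_clinear (T ^^ n)"
proof (induction n)
  case 0
  show ?case by (simp add: bounded_clinear_def id_def bounded_linear_ident)
next
  case (Suc n)
  then show ?case
    using bounded_clinear_compose[of T "T ^^ n"] by (simp add: o_def)
qed

lemma bounded_clinear_sum:
  "(\<And>i. i \<in> I \<Longrightarrow> bounded_clinear (f i)) \<Longrightarrow> bounded_clinear (\<lambda>x. \<Sum>i\<in>I. f i x)"
  by (auto simp: bounded_clinear_def complex_module.scale_sum_right intro: bounded_linear_sum)

text \<open>Any bound on the degree may replace the degree in the defining sum, so polynomials of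
  different degrees can be evaluated over a common range.\<close>

lemma poly_op_altdef:
  assumes "\<And>i. i \<ge> N \<Longrightarrow> coeff p i = 0"
  shows "poly_op p T x = (\<Sum>i<N. coeff p i *\<^sub>C (T ^^ i) x)"
proof -
  have "coeff p i = 0" if "i > degree p \<or> i \<ge> N" for i
    using that assms by (auto simp: coeff_eq_0)
  then show ?thesis
    unfolding poly_op_def by (intro sum.mono_neutral_cong) (auto simp: not_le not_less)
qed

lemma poly_op_add: "poly_op (p + q) T x = poly_op p T x + poly_op q T x"
proof -
  let ?N = "Suc (degree p + degree q)"
  have "coeff p i = 0" "coeff q i = 0" if "i \<ge> ?N" for i
    using that by (auto intro!: coeff_eq_0)
  then show ?thesis
    by (simp add: poly_op_altdef[of ?N] sum.distrib complex_module.scale_left_distrib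
        del: sum.lessThan_Suc)
qed

lemma poly_op_0 [simp]: "poly_op 0 T x = 0"
  by (simp add: poly_op_def)

lemma poly_op_smult: "poly_op (smult c p) T x = c *\<^sub>C poly_op p T x"
  by (cases "c = 0") (simp_all add: poly_op_def complex_module.scale_sum_right)

lemma poly_op_diff: "poly_op (p - q) T x = poly_op p T x - poly_op q T x"
  using poly_op_add[of "p - q" q T x] by simp

lemma poly_op_sum: "poly_op (\<Sum>i\<in>I. p i) T x = (\<Sum>i\<in>I. poly_op (p i) T x)"
  by (induction I rule: infinite_finite_induct) (simp_all add: poly_op_add)

lemma poly_op_monom: "poly_op (monom c n) T x = c *\<^sub>C (T ^^ n) x"
proof -
  have "poly_op (monom c n) T x = (\<Sum>i<Suc n. coeff (monom c n) i *\<^sub>C (T ^^ i) x)"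
    by (rule poly_op_altdef) simp
  then show ?thesis by simp
qed

lemma poly_op_pCons:
  assumes T: "bounded_clinear T"
  shows "poly_op (pCons c p) T x = c *\<^sub>C x + T (poly_op p T x)"
proof -
  interpret bounded_linear T using T by (simp add: bounded_clinear_def)
  have "poly_op (pCons c p) T x
      = (\<Sum>i<Suc (Suc (degree p)). coeff (pCons c p) i *\<^sub>C (T ^^ i) x)"
    by (rule poly_op_altdef) (auto simp: coeff_pCons coeff_eq_0 split: nat.split)
  also have "\<dots> = c *\<^sub>C x + (\<Sum>i<Suc (degree p). coeff p i *\<^sub>C T ((T ^^ i) x))"
    by (subst sum.lessThan_Suc_shift) (simp del: sum.lessThan_Suc)
  also have "(\<Sum>i<Suc (degree p). coeff p i *\<^sub>C T ((T ^^ i) x)) = T (poly_op p T x)"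
    using T by (simp add: poly_op_def sum bounded_clinear_def lessThan_Suc_atMost
        del: sum.lessThan_Suc)
  finally show ?thesis .
qed

text \<open>Together with additivity this makes evaluation at \<open>T\<close> a ring homomorphism into the
  operators under composition.\<close>

lemma poly_op_mult:
  assumes T: "bounded_clinear T"
  shows "poly_op (p * q) T x = poly_op p T (poly_op q T x)"
proof (induction p)
  case 0
  show ?case by simp
next
  case (pCons c p)
  then show ?case
    by (simp add: poly_op_add poly_op_smult poly_op_pCons[OF T])
qed

lemma poly_op_eq_of_dvd_diff:
  assumes T: "bounded_clinear T" and P: "poly_op P T = (\<lambda>x. 0)" and dvd: "P dvd p - q"
  shows "poly_op p T x = poly_op q T x"
proof -
  obtain h where "p - q = h * P"
    using dvd by (auto simp: dvd_def mult.commute)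
  then have "poly_op p T x - poly_op q T x = poly_op h T 0"
    by (simp add: poly_op_diff[symmetric] poly_op_mult[OF T] P)
  also have "\<dots> = 0"
    using poly_op_mult[OF T, of h 0 x] by simp
  finally show ?thesis by simp
qed

section \<open>Powers of an algebraic operator\<close>

lemma coeff_rec_poly:
  "coeff (rec_poly r a) i =
    (if i = r then 1 else if i < r then - complex_of_real (a (r - 1 - i)) else 0)"
proof -
  have "(\<Sum>j<r. coeff (monom (complex_of_real (a j)) (r - 1 - j)) i)
      = (\<Sum>j<r. if j = r - 1 - i \<and> i < r then complex_of_real (a j) else 0)"
    by (intro sum.cong) auto
  then show ?thesis
    by (auto simp: rec_poly_def coeff_sum)
qed

lemma degree_rec_poly: "degree (rec_poly r a) = r"
  by (intro antisym degree_le le_degree) (auto simp: coeff_rec_poly)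

lemma funpow_recurrence:
  assumes T: "bounded_clinear T" and P: "poly_op (rec_poly r a) T = (\<lambda>x. 0)" and n: "n \<ge> r"
  shows "(T ^^ n) x = (\<Sum>j<r. a j *\<^sub>R (T ^^ (n - 1 - j)) x)"
proof -
  interpret bounded_linear "T ^^ (n - r)"
    using bounded_clinear_funpow[OF T] by (simp add: bounded_clinear_def)
  have "(T ^^ r) x = (\<Sum>j<r. a j *\<^sub>R (T ^^ (r - 1 - j)) x)"
    using fun_cong[OF P, of x]
    by (simp add: rec_poly_def poly_op_diff poly_op_sum poly_op_monom scaleC_of_real)
  then have "(T ^^ (n - r)) ((T ^^ r) x) = (\<Sum>j<r. a j *\<^sub>R (T ^^ (n - r)) ((T ^^ (r - 1 - j)) x))"
    by (simp add: sum scaleR)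
  also have "\<dots> = (\<Sum>j<r. a j *\<^sub>R (T ^^ (n - 1 - j)) x)"
  proof (intro sum.cong refl)
    fix j assume "j \<in> {..<r}"
    then have "n - 1 - j = (n - r) + (r - 1 - j)" using n by auto
    then show "a j *\<^sub>R (T ^^ (n - r)) ((T ^^ (r - 1 - j)) x) = a j *\<^sub>R (T ^^ (n - 1 - j)) x"
      by (simp add: funpow_add)
  qed
  also have "(T ^^ (n - r)) ((T ^^ r) x) = (T ^^ n) x"
    using n funpow_add[of "n - r" r T] by simp
  finally show ?thesis .
qed

theorem corollary4p5:
  fixes r q :: nat and a :: "nat \<Rightarrow> real"
    and lam :: "nat \<Rightarrow> complex" and m :: "nat \<Rightarrow> nat"
  assumes separable: "separable_space (euclidean :: 'a::complex_hilbert topology)"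
    and r: "r \<ge> 2"
    and roots: "bij_betw lam {1..q} {z. poly (rec_poly r a) z = 0}"
    and mult: "\<And>i. i \<in> {1..q} \<Longrightarrow> m i = order (lam i) (rec_poly r a)"
  shows "\<exists>c :: nat \<Rightarrow> nat \<Rightarrow> nat \<Rightarrow> complex.
    \<forall>T :: 'a \<Rightarrow> 'a.
      bounded_clinear T \<and> algebraic_op T \<and> is_monic_minimal_poly T (rec_poly r a) \<longrightarrow>
      (\<forall>n\<ge>r. T ^^ n = (\<lambda>x. \<Sum>s<r. rho a (n - s) r *\<^sub>R W_op a r T s x)) \<and>
      (\<exists>C :: nat \<Rightarrow> nat \<Rightarrow> 'a \<Rightarrow> 'a.
        (\<forall>i\<in>{1..q}. \<forall>j<m i. bounded_clinear (C i j) \<and>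
          C i j = (\<lambda>x. \<Sum>s<r. c i j s *\<^sub>C (T ^^ s) x)) \<and>
        (\<forall>n\<ge>r. T ^^ n =
          (\<lambda>x. \<Sum>i=1..q. \<Sum>j<m i. (of_nat n ^ j * lam i ^ n) *\<^sub>C C i j x)))"
proof -
  define P where "P = rec_poly r a"
  have deg: "degree P = r" and monic: "lead_coeff P = 1"
    by (simp_all add: P_def degree_rec_poly coeff_rec_poly)
  have "P \<noteq> 0" using monic by auto
  obtain Q :: "complex \<Rightarrow> nat \<Rightarrow> complex poly" where Q: "\<And>n. n \<ge> r \<Longrightarrow>
      P dvd monom 1 n - (\<Sum>z | poly P z = 0. \<Sum>j<order z P. smult (of_nat n ^ j * z ^ n) (Q z j))"
    using monom_binet_mod[OF monic] r deg by auto
  define c where "c i j s = coeff (Q (lam i) j mod P) s" for i j s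
  show ?thesis
  proof (rule exI[of _ c], intro allI impI, elim conjE)
    fix T :: "'a \<Rightarrow> 'a"
    assume T: "bounded_clinear T" and "is_monic_minimal_poly T (rec_poly r a)"
    then have P_op: "poly_op P T = (\<lambda>x. 0)"
      by (simp add: is_monic_minimal_poly_def P_def)
    define C where "C i j x = (\<Sum>s<r. c i j s *\<^sub>C (T ^^ s) x)" for i j x
    (* Reducing modulo P leaves r coefficients and does not change the operator. *)
    have C_eq: "C i j x = poly_op (Q (lam i) j) T x" for i j x
    proof -
      have "coeff (Q (lam i) j mod P) s = 0" if "s \<ge> r" for s
        using that degree_mod_less[OF \<open>P \<noteq> 0\<close>, of "Q (lam i) j"] deg by (auto intro: coeff_eq_0)
      then have "C i j x = poly_op (Q (lam i) j mod P) T x"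
        by (simp add: C_def c_def poly_op_altdef[of r])
      also have "\<dots> = poly_op (Q (lam i) j) T x"
        by (rule poly_op_eq_of_dvd_diff[OF T P_op]) (simp add: mod_eq_dvd_iff[symmetric])
      finally show ?thesis .
    qed
    have "T ^^ n = (\<lambda>x. \<Sum>s<r. rho a (n - s) r *\<^sub>R W_op a r T s x)" if n: "n \<ge> r" for n
      unfolding W_op_def
      by (rule ext, rule recurrence_solution_rho[OF _ n])
        (use funpow_recurrence[OF T P_op[unfolded P_def]] in simp)
    moreover have "bounded_clinear (C i j)" for i j
      unfolding C_def[abs_def]
      by (intro bounded_clinear_sum bounded_clinear_compose[OF bounded_clinear_scaleC]
          bounded_clinear_funpow T)
    moreover have "(T ^^ n) x = (\<Sum>i=1..q. \<Sum>j<m i. (of_nat n ^ j * lam i ^ n) *\<^sub>C C i j x)"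
      if n: "n \<ge> r" for n x
    proof -
      have "(T ^^ n) x = poly_op (monom 1 n) T x"
        by (simp add: poly_op_monom)
      also have "\<dots> = (\<Sum>z | poly P z = 0. \<Sum>j<order z P.
          (of_nat n ^ j * z ^ n) *\<^sub>C poly_op (Q z j) T x)"
        by (subst poly_op_eq_of_dvd_diff[OF T P_op Q[OF n]]) (simp add: poly_op_sum poly_op_smult)
      also have "\<dots> = (\<Sum>i=1..q. \<Sum>j<order (lam i) P.
          (of_nat n ^ j * lam i ^ n) *\<^sub>C poly_op (Q (lam i) j) T x)"
        using roots unfolding P_def[symmetric] by (rule sum.reindex_bij_betw[symmetric])
      also have "\<dots> = (\<Sum>i=1..q. \<Sum>j<m i. (of_nat n ^ j * lam i ^ n) *\<^sub>C C i j x)"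
        by (intro sum.cong refl) (simp_all add: mult C_eq P_def)
      finally show ?thesis .
    qed
    ultimately show "(\<forall>n\<ge>r. T ^^ n = (\<lambda>x. \<Sum>s<r. rho a (n - s) r *\<^sub>R W_op a r T s x)) \<and>
      (\<exists>C :: nat \<Rightarrow> nat \<Rightarrow> 'a \<Rightarrow> 'a.
        (\<forall>i\<in>{1..q}. \<forall>j<m i. bounded_clinear (C i j) \<and>
          C i j = (\<lambda>x. \<Sum>s<r. c i j s *\<^sub>C (T ^^ s) x)) \<and>
        (\<forall>n\<ge>r. T ^^ n =
          (\<lambda>x. \<Sum>i=1..q. \<Sum>j<m i. (of_nat n ^ j * lam i ^ n) *\<^sub>C C i j x)))"
      by (intro conjI exI[of _ C] ballI allI impI ext) (simp_all add: C_def)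
  qed
qed

end
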